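(* Let $(\bar A,\bar B,\bar C)$ be a structural system with feedback matrix $\bar K$ and cost vectors $p_u\in\mathbb{R}^m_{\ge0}$, $p_y\in\mathbb{R}^p_{\ge0}$, and assume that all states are spanned by a disjoint union of cycles in $\mathcal{D}(\bar A,\bar B,\bar C,\bar K)$. Let $(\mathcal{I}^\star_{\mathcal{C}},\mathcal{J}^\star_{\mathcal{C}})$ be an optimal solution to the minimum cost disjoint cycle problem, with optimal cost $p(\mathcal{I}^\star_{\mathcal{C}},\mathcal{J}^\star_{\mathcal{C}})$, and let $c^\star$ be the optimal cost of the minimum cost perfect matching problem on the bipartite graph $\mathcal{B}(\bar A,\bar B,\bar C,\bar K)$ with edge cost $c$. Then $c^\star=p(\mathcal{I}^\star_{\mathcal{C}},\mathcal{J}^\star_{\mathcal{C}})$. Moreover, for a minimum cost perfect matching $M$ of $\mathcal{B}(\bar A,\bar B,\bar C,\bar K)$ under $c$, the selected index sets $\mathcal{I}(M)=\{i:(x'_j,u_i)\in M\text{ for some }j\}$ and $\mathcal{J}(M)=\{j:(y'_j,x_i)\in M\text{ for some }i\}$ form an optimal solution $(\mathcal{I}(M),\mathcal{J}(M))$ to the minimum cost disjoint cycle problem.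
   Context: $\bar A\in\{\star,0\}^{n\times n}$, $\bar B\in\{\star,0\}^{n\times m}$, $\bar C\in\{\star,0\}^{p\times n}$, $\bar K\in\{\star,0\}^{m\times p}$. **System digraph** $\mathcal{D}(\bar A,\bar B,\bar C,\bar K)$: vertices $x_1,\dots,x_n$ (states), $u_1,\dots,u_m$ (inputs), $y_1,\dots,y_p$ (outputs); edges $(x_j,x_i)$ iff $\bar A_{ij}=\star$, $(u_j,x_i)$ iff $\bar B_{ij}=\star$, $(x_j,y_i)$ iff $\bar C_{ij}=\star$, $(y_j,u_i)$ iff $\bar K_{ij}=\star$. All states are spanned by a disjoint union of cycles if there is a finite family of pairwise vertex-disjoint directed cycles (self-loops allowed) in this digraph whose vertices together include all of $x_1,\dots,x_n$. For $\mathcal{I}\subseteq\{1,\dots,m\}$, $\mathcal{J}\subseteq\{1,\dots,p\}$: $\bar B_{\mathcal{I}}$ keeps only columns in $\mathcal{I}$, $\bar C_{\mathcal{J}}$ only rows in $\mathcal{J}$, $\bar K_{(\mathcal{I}\times\mathcal{J})}$ only rows in $\mathcal{I}$ and columns in $\mathcal{J}$; $p(\mathcal{I},\mathcal{J})=\sum_{i\in\mathcal{I}}p_u(i)+\sum_{j\in\mathcal{J}}p_y(j)$. **Minimum cost disjoint cycle problem:** find $\mathcal{I}\subseteq\{1,\dots,m\}$, $\mathcal{J}\subseteq\{1,\dots,p\}$ minimizing $p(\mathcal{I},\mathcal{J})$ subject to all states being spanned by a disjoint union of cycles in $\mathcal{D}(\bar A,\bar B_{\mathcal{I}},\bar C_{\mathcal{J}},\bar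 K_{(\mathcal{I}\times\mathcal{J})})$. **Bipartite graph** $\mathcal{B}(\bar A,\bar B,\bar C,\bar K)$: left vertices $x'_1,\dots,x'_n,u'_1,\dots,u'_m,y'_1,\dots,y'_p$; right vertices $x_1,\dots,x_n,u_1,\dots,u_m,y_1,\dots,y_p$; edges $(x'_i,x_j)$ iff $\bar A_{ij}=\star$; $(x'_i,u_j)$ iff $\bar B_{ij}=\star$; $(y'_j,x_i)$ iff $\bar C_{ji}=\star$; $(u'_i,y_j)$ iff $\bar K_{ij}=\star$; $(u'_i,u_i)$ for all $i$; $(y'_j,y_j)$ for all $j$. Edge costs: $c(u'_i,y_j)=p_u(i)+p_y(j)$, and $c(e)=0$ for every other edge. The cost of a matching is the sum of its edge costs. *)

theory Defs
  imports Complex_Main "HOL-Library.Disjoint_Sets" "Graph_Theory.Graph_Theory"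
begin

section \<open>Structural matrices and the system digraph\<close>

datatype entry = Star | Zero

text \<open>
  A structural matrix is a function of its row and column index. Its dimensions are not part of
  the function: the row and column index sets are supplied where the matrix is used, and entries
  outside of them are never inspected. Indices are 1-based, so an \<open>n \<times> m\<close> matrix is indexed by
  \<open>{1..n}\<close> and \<open>{1..m}\<close>.
\<close>

type_synonym structural_matrix = "nat \<Rightarrow> nat \<Rightarrow> entry"

datatype vertex = X nat | U nat | Y nat

text \<open>
  The digraph has states \<open>{1..n}\<close>, input labels \<open>I\<close> and output labels \<open>J\<close>, so \<open>A\<close> is read on
  \<open>{1..n} \<times> {1..n}\<close>, \<open>B\<close> on \<open>{1..n} \<times> I\<close>, \<open>C\<close> on \<open>J \<times> {1..n}\<close> and \<open>K\<close> on \<open>I \<times> J\<close>.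
  With \<open>I = {1..m}\<close> and \<open>J = {1..p}\<close> this is the digraph of \<open>(A, B, C, K)\<close>; with arbitrary
  \<open>I\<close> and \<open>J\<close> it is the digraph of \<open>A\<close> with the submatrices of \<open>B\<close>, \<open>C\<close> and \<open>K\<close> that keep the
  columns \<open>I\<close>, the rows \<open>J\<close>, and the rows \<open>I\<close> and columns \<open>J\<close>, respectively, kept rows and
  columns retaining their original labels.
\<close>

definition system_digraph ::
  "nat \<Rightarrow> nat set \<Rightarrow> nat set \<Rightarrow> structural_matrix \<Rightarrow> structural_matrix \<Rightarrow> structural_matrix \<Rightarrow>
   structural_matrix \<Rightarrow> vertex pair_pre_digraph" where
  "system_digraph n I J A B C K =
    \<lparr> pverts = X ` {1..n} \<union> U ` I \<union> Y ` J,
      parcs =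
        {(X j, X i) | i j. i \<in> {1..n} \<and> j \<in> {1..n} \<and> A i j = Star} \<union>
        {(U j, X i) | i j. i \<in> {1..n} \<and> j \<in> I \<and> B i j = Star} \<union>
        {(X j, Y i) | i j. i \<in> J \<and> j \<in> {1..n} \<and> C i j = Star} \<union>
        {(Y j, U i) | i j. i \<in> I \<and> j \<in> J \<and> K i j = Star} \<rparr>"

text \<open>
  A cycle is a nonempty list of arcs without repeated vertices, and loops count as cycles; since
  every vertex of a cycle is the tail of one of its arcs, \<open>fst ` set c\<close> is its vertex set.
\<close>

definition states_spanned_by_disjoint_cycles :: "nat \<Rightarrow> vertex pair_pre_digraph \<Rightarrow> bool" where
  "states_spanned_by_disjoint_cycles n D \<longleftrightarrow>
    (\<exists>F. finite F \<and>
         (\<forall>c\<in>F. pre_digraph.cycle (with_proj D) c) \<and>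
         disjoint_family_on (\<lambda>c. fst ` set c) F \<and>
         X ` {1..n} \<subseteq> (\<Union>c\<in>F. fst ` set c))"

section \<open>The minimum cost disjoint cycle problem\<close>

definition selection_cost ::
  "(nat \<Rightarrow> real) \<Rightarrow> (nat \<Rightarrow> real) \<Rightarrow> nat set \<Rightarrow> nat set \<Rightarrow> real" where
  "selection_cost pu py I J = (\<Sum>i\<in>I. pu i) + (\<Sum>j\<in>J. py j)"

definition cycle_feasible ::
  "nat \<Rightarrow> nat \<Rightarrow> nat \<Rightarrow> structural_matrix \<Rightarrow> structural_matrix \<Rightarrow> structural_matrix \<Rightarrow>
   structural_matrix \<Rightarrow> nat set \<Rightarrow> nat set \<Rightarrow> bool" where
  "cycle_feasible n m p A B C K I J \<longleftrightarrow>
    I \<subseteq> {1..m} \<and> J \<subseteq> {1..p} \<and>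
    states_spanned_by_disjoint_cycles n (system_digraph n I J A B C K)"

definition cycle_optimal ::
  "nat \<Rightarrow> nat \<Rightarrow> nat \<Rightarrow> structural_matrix \<Rightarrow> structural_matrix \<Rightarrow> structural_matrix \<Rightarrow>
   structural_matrix \<Rightarrow> (nat \<Rightarrow> real) \<Rightarrow> (nat \<Rightarrow> real) \<Rightarrow> nat set \<Rightarrow> nat set \<Rightarrow> bool" where
  "cycle_optimal n m p A B C K pu py I J \<longleftrightarrow>
    is_arg_min (\<lambda>(I, J). selection_cost pu py I J)
      (\<lambda>(I, J). cycle_feasible n m p A B C K I J) (I, J)"

section \<open>Bipartite graphs and minimum cost perfect matchings\<close>

text \<open>
  Edges are pairs (left vertex, right vertex). The two sides are told apart by the position in
  the pair, so the vertex sets may overlap as sets: below, the left copy of a system vertex and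
  its right copy are the same value.
\<close>

record ('a, 'b) bipartite_graph =
  left_verts :: "'a set"
  right_verts :: "'b set"
  edges :: "('a \<times> 'b) set"

definition matching :: "('a, 'b) bipartite_graph \<Rightarrow> ('a \<times> 'b) set \<Rightarrow> bool" where
  "matching G M \<longleftrightarrow>
    M \<subseteq> edges G \<and> (\<forall>e\<in>M. \<forall>f\<in>M. e \<noteq> f \<longrightarrow> fst e \<noteq> fst f \<and> snd e \<noteq> snd f)"

definition perfect_matching :: "('a, 'b) bipartite_graph \<Rightarrow> ('a \<times> 'b) set \<Rightarrow> bool" where
  "perfect_matching G M \<longleftrightarrow>
    matching G M \<and> fst ` M = left_verts G \<and> snd ` M = right_verts G"

definition matching_cost :: "('a \<times> 'b \<Rightarrow> real) \<Rightarrow> ('a \<times> 'b) set \<Rightarrow> real" where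
  "matching_cost c M = (\<Sum>e\<in>M. c e)"

definition min_cost_perfect_matching ::
  "('a, 'b) bipartite_graph \<Rightarrow> ('a \<times> 'b \<Rightarrow> real) \<Rightarrow> ('a \<times> 'b) set \<Rightarrow> bool" where
  "min_cost_perfect_matching G c M \<longleftrightarrow> is_arg_min (matching_cost c) (perfect_matching G) M"

text \<open>Meaningful only if the graph has a perfect matching; \<open>Inf {}\<close> is unspecified on the reals.\<close>

definition perfect_matching_opt_cost ::
  "('a, 'b) bipartite_graph \<Rightarrow> ('a \<times> 'b \<Rightarrow> real) \<Rightarrow> real" where
  "perfect_matching_opt_cost G c = (INF M\<in>{M. perfect_matching G M}. matching_cost c M)"

definition system_bipartite_graph ::
  "nat \<Rightarrow> nat \<Rightarrow> nat \<Rightarrow> structural_matrix \<Rightarrow> structural_matrix \<Rightarrow> structural_matrix \<Rightarrow>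
   structural_matrix \<Rightarrow> (vertex, vertex) bipartite_graph" where
  "system_bipartite_graph n m p A B C K =
    \<lparr> left_verts = X ` {1..n} \<union> U ` {1..m} \<union> Y ` {1..p},
      right_verts = X ` {1..n} \<union> U ` {1..m} \<union> Y ` {1..p},
      edges =
        {(X i, X j) | i j. i \<in> {1..n} \<and> j \<in> {1..n} \<and> A i j = Star} \<union>
        {(X i, U j) | i j. i \<in> {1..n} \<and> j \<in> {1..m} \<and> B i j = Star} \<union>
        {(Y j, X i) | i j. i \<in> {1..n} \<and> j \<in> {1..p} \<and> C j i = Star} \<union>
        {(U i, Y j) | i j. i \<in> {1..m} \<and> j \<in> {1..p} \<and> K i j = Star} \<union>
        {(U i, U i) | i. i \<in> {1..m}} \<union>
        {(Y j, Y j) | j. j \<in> {1..p}} \<rparr>"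

fun edge_cost :: "(nat \<Rightarrow> real) \<Rightarrow> (nat \<Rightarrow> real) \<Rightarrow> vertex \<times> vertex \<Rightarrow> real" where
  "edge_cost pu py (U i, Y j) = pu i + py j"
| "edge_cost pu py _ = 0"

definition selected_inputs :: "(vertex \<times> vertex) set \<Rightarrow> nat set" where
  "selected_inputs M = {i. \<exists>j. (X j, U i) \<in> M}"

definition selected_outputs :: "(vertex \<times> vertex) set \<Rightarrow> nat set" where
  "selected_outputs M = {j. \<exists>i. (Y j, X i) \<in> M}"

end

theory Submission
  imports Defs
begin

text \<open>
  A set of arcs is a disjoint union of cycles exactly if it is the graph of a permutation of its
  vertices. The edges of the bipartite graph are the reversed arcs of the system digraph together
  with loops at the inputs and outputs. Deleting these loops from a perfect matching and reversing
  the rest thus gives disjoint cycles through all states, and every such family of cycles arises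
  in this way after adding loops at the inputs and outputs it misses. An input or output is
  selected exactly if it lies on an edge \<open>(U i, Y j)\<close> of the matching, so the cost of a perfect
  matching is the cost of its selection.
\<close>

section \<open>Graphs of permutations as arc sets\<close>

text \<open>The permutation is kept as a set of pairs instead of a function, since a matching and
  the arcs of a family of cycles both have this form, up to reversal.\<close>

definition permutation_arcs :: "('a \<times> 'a) set \<Rightarrow> bool" where
  "permutation_arcs N \<longleftrightarrow> inj_on fst N \<and> inj_on snd N \<and> fst ` N = snd ` N"

lemma fst_image_converse: "fst ` N\<inverse> = snd ` N"
  by force

lemma permutation_arcs_converse: "permutation_arcs (N\<inverse>) \<longleftrightarrow> permutation_arcs N"
proof -
  have "snd ` N\<inverse> = fst ` N"
    by force
  moreover have "inj_on fst (N\<inverse>) \<longleftrightarrow> inj_on snd N" "inj_on snd (N\<inverse>) \<longleftrightarrow> inj_on fst N"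
    unfolding inj_on_def Ball_def split_paired_All by simp_all blast+
  ultimately show ?thesis
    unfolding permutation_arcs_def fst_image_converse by auto
qed

lemma image_Id_on: "fst ` Id_on W = W" "snd ` Id_on W = W"
  by force+

lemma permutation_arcs_Id_on: "permutation_arcs (Id_on W)"
  by (auto simp: permutation_arcs_def image_Id_on inj_on_def)

text \<open>Injectivity of \<open>fst\<close> and \<open>snd\<close> on \<open>N\<close> makes both
  images commute with the difference, and \<open>L\<close> removes the same vertices as tails and as
  heads.\<close>

lemma permutation_arcs_Diff:
  assumes "permutation_arcs N" "permutation_arcs L" "L \<subseteq> N"
  shows "permutation_arcs (N - L)"
    and "fst ` (N - L) = fst ` N - fst ` L"
proof -
  have "fst ` (N - L) = fst ` N - fst ` L" "snd ` (N - L) = snd ` N - snd ` L"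
    using assms by (auto simp: permutation_arcs_def inj_on_image_set_diff[where C = N])
  then show "permutation_arcs (N - L)" "fst ` (N - L) = fst ` N - fst ` L"
    using assms by (auto simp: permutation_arcs_def inj_on_diff)
qed

text \<open>The head of an arc of \<open>L\<close> is also a tail of \<open>L\<close>. Two arcs with
  a common tail or a common head thus lie in the same member of the family, where injectivity
  applies.\<close>

lemma permutation_arcs_Union:
  assumes "\<And>L. L \<in> \<N> \<Longrightarrow> permutation_arcs L"
    and "\<And>L L'. L \<in> \<N> \<Longrightarrow> L' \<in> \<N> \<Longrightarrow> L \<noteq> L' \<Longrightarrow> fst ` L \<inter> fst ` L' = {}"
  shows "permutation_arcs (\<Union>\<N>)"
proof -
  have same: "L = L'" if "L \<in> \<N>" "L' \<in> \<N>" "v \<in> fst ` L" "v \<in> fst ` L'" for L L' v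
    using assms(2) that by blast
  have eq: "fst ` L = snd ` L" and inj: "inj_on fst L" "inj_on snd L" if "L \<in> \<N>" for L
    using assms(1)[OF that] by (auto simp: permutation_arcs_def)
  have "inj_on fst (\<Union>\<N>)"
  proof (rule inj_onI)
    fix e f assume ef: "e \<in> \<Union>\<N>" "f \<in> \<Union>\<N>" "fst e = fst f"
    then obtain L L' where L: "L \<in> \<N>" "L' \<in> \<N>" "e \<in> L" "f \<in> L'"
      by auto
    then have "L = L'"
      using same[of L L' "fst e"] ef by (metis imageI)
    then show "e = f"
      using inj L ef by (metis inj_onD)
  qed
  moreover have "inj_on snd (\<Union>\<N>)"
  proof (rule inj_onI)
    fix e f assume ef: "e \<in> \<Union>\<N>" "f \<in> \<Union>\<N>" "snd e = snd f"
    then obtain L L' where L: "L \<in> \<N>" "L' \<in> \<N>" "e \<in> L" "f \<in> L'"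
      by auto
    then have "L = L'"
      using same[of L L' "snd e"] eq ef by (metis imageI)
    then show "e = f"
      using inj L ef by (metis inj_onD)
  qed
  moreover have "fst ` \<Union>\<N> = snd ` \<Union>\<N>"
    using eq by (simp add: image_Union)
  ultimately show ?thesis
    by (simp add: permutation_arcs_def)
qed

section \<open>Cycles and cycle decomposition\<close>

text \<open>Replaces the walk notions of general digraphs by \<open>pcas\<close> and
  \<open>pawalk_verts\<close>, which depend on the list of pairs alone. The digraph then enters only
  through the start vertex and the arcs.\<close>

lemma cycle_with_proj:
  "pre_digraph.cycle (with_proj D) c \<longleftrightarrow>
    (\<exists>u. u \<in> pverts D \<and> set c \<subseteq> parcs D \<and> pcas u c u \<and>
         distinct (tl (pawalk_verts u c)) \<and> c \<noteq> [])"
  by (auto simp: pre_digraph.cycle_def pre_digraph.awalk_def cas_with_proj_eq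
      awalk_verts_with_proj_eq)

text \<open>Each head is the next tail, so the tails lack at most the last vertex \<open>v\<close>
  and the heads at most the first vertex \<open>u\<close>.\<close>

lemma pcas_image_fst_snd:
  "pcas u c v \<Longrightarrow> insert v (fst ` set c) = insert u (snd ` set c)"
  by (induct c arbitrary: u) auto

lemma pcas_ends_in_image:
  "pcas u c v \<Longrightarrow> c \<noteq> [] \<Longrightarrow> u \<in> fst ` set c \<and> v \<in> snd ` set c"
proof (induct c arbitrary: u)
  case (Cons e c)
  then show ?case
    by (cases "c = []") auto
qed simp

lemma pawalk_verts_pcas: "pcas u c v \<Longrightarrow> pawalk_verts u c = u # map snd c"
  by (induct c arbitrary: u) auto

text \<open>The vertices after the first one are the heads of the arcs, so the heads are distinct.
  Tails and heads form the same set on a closed walk, and counting then shows that the tails are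
  distinct too.\<close>

lemma permutation_arcs_cycle:
  assumes "pre_digraph.cycle (with_proj D) c"
  shows "permutation_arcs (set c)"
proof -
  obtain u where u: "pcas u c u" "distinct (map snd c)" "c \<noteq> []"
    using assms by (auto simp: cycle_with_proj pawalk_verts_pcas)
  have eq: "fst ` set c = snd ` set c"
    using pcas_image_fst_snd[OF u(1)] pcas_ends_in_image[OF u(1,3)] by (simp add: insert_absorb)
  have "card (fst ` set c) = card (set c)"
    using u(2) eq by (metis distinct_map card_image)
  then have "inj_on fst (set c)"
    by (simp add: eq_card_imp_inj_on)
  with eq u(2) show ?thesis
    by (simp add: permutation_arcs_def distinct_map)
qed

text \<open>Every head is again a tail, so walks inside \<open>N\<close> can be prolonged at will.
  As there are finitely many vertices, a long walk repeats one and contains a cycle.\<close>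

lemma ex_cycle_in_arcs:
  assumes "pair_wf_digraph D" "finite N" "N \<noteq> {}" "N \<subseteq> parcs D" "snd ` N \<subseteq> fst ` N"
  shows "\<exists>c. pre_digraph.cycle (with_proj D) c \<and> set c \<subseteq> N"
proof -
  interpret D: pair_wf_digraph D by fact
  \<comment> \<open>Walks in \<open>H\<close> use only arcs of \<open>N\<close>, so the cycle found
    there lies in \<open>N\<close> and not merely in \<open>D\<close>.\<close>
  define H where "H = \<lparr> pverts = fst ` N, parcs = N \<rparr>"
  have H: "pverts H = fst ` N" "parcs H = N"
    by (simp_all add: H_def)
  interpret H: pair_fin_digraph H
    using assms by unfold_locales (auto simp: H)
  have walk: "\<exists>p v. H.awalk u p v \<and> length p = k" if "u \<in> fst ` N" for u k
    using that
  proof (induct k arbitrary: u)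
    case 0
    then show ?case
      by (intro exI[of _ "[]"] exI[of _ u]) (simp add: H.awalk_Nil_iff H)
  next
    case (Suc k)
    then obtain w where w: "(u, w) \<in> N"
      by auto
    then have "w \<in> fst ` N"
      using assms(5) by force
    then obtain p v where "H.awalk w p v" "length p = k"
      using Suc.hyps by blast
    with w have "H.awalk u ((u, w) # p) v \<and> length ((u, w) # p) = Suc k"
      by (force simp: H.awalk_Cons_iff H)
    then show ?case
      by blast
  qed
  obtain u where "u \<in> fst ` N"
    using assms(3) by auto
  \<comment> \<open>A walk with as many arcs as \<open>H\<close> has vertices visits one vertex more
    than that, counted with repetition.\<close>
  then obtain p v where p: "H.awalk u p v" "length p = card (fst ` N)"
    using walk by blast
  have "\<not> distinct (pawalk_verts u p)"
  proof
    assume "distinct (pawalk_verts u p)"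
    then have "Suc (length p) = card (set (pawalk_verts u p))"
      by (simp add: distinct_card H.length_awalk_verts)
    also have "\<dots> \<le> card (fst ` N)"
    proof (rule card_mono)
      show "set (pawalk_verts u p) \<subseteq> fst ` N"
        using p(1) unfolding H.awalk_conv H by (elim conjE)
    qed (simp add: assms(2))
    finally show False
      using p(2) by simp
  qed
  then obtain r where "H.closed_w r"
    using H.awalk_cyc_decompE'[OF p(1)] by blast
  then obtain c where c: "H.cycle c"
    using H.closed_w_imp_cycle by blast
  then obtain u where u: "u \<in> fst ` N" "set c \<subseteq> N" "pcas u c u"
      "distinct (tl (pawalk_verts u c))" "c \<noteq> []"
    unfolding cycle_with_proj H by blast
  then have "u \<in> pverts D"
    using assms(4) by (auto dest: D.in_arcsD1)
  then show ?thesis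
    unfolding cycle_with_proj using u assms(4) by blast
qed

text \<open>Removing one cycle from \<open>N\<close> leaves the graph of a permutation of the
  remaining vertices, so induction supplies the other cycles, disjoint from the first.\<close>

lemma permutation_arcs_cycle_decomposition:
  assumes "pair_wf_digraph D" "finite N" "permutation_arcs N" "N \<subseteq> parcs D"
  shows "\<exists>F. finite F \<and> (\<forall>c\<in>F. pre_digraph.cycle (with_proj D) c) \<and>
    disjoint_family_on (\<lambda>c. fst ` set c) F \<and> (\<Union>c\<in>F. fst ` set c) = fst ` N"
  using assms(2-)
proof (induct rule: finite_psubset_induct)
  case (psubset N)
  show ?case
  proof (cases "N = {}")
    case True
    then show ?thesis
      by (intro exI[of _ "{}"]) (auto simp: disjoint_family_on_def)
  next
    case False
    then obtain c where c: "pre_digraph.cycle (with_proj D) c" "set c \<subseteq> N"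
      using ex_cycle_in_arcs[OF assms(1) psubset.hyps(1)] psubset.prems
      by (auto simp: permutation_arcs_def)
    have "set c \<noteq> {}"
      using c(1) by (auto simp: cycle_with_proj)
    then obtain e where "e \<in> set c"
      by (cases c) auto
    then have "N - set c \<subset> N"
      using c(2) by auto
    note rest = permutation_arcs_Diff[OF psubset.prems(1) permutation_arcs_cycle[OF c(1)] c(2)]
    have "N - set c \<subseteq> parcs D"
      using psubset.prems(2) by auto
    note IH = psubset.hyps(2)[OF \<open>N - set c \<subset> N\<close> rest(1) this, unfolded rest(2)]
    obtain F where F: "finite F" "\<forall>c\<in>F. pre_digraph.cycle (with_proj D) c"
      "disjoint_family_on (\<lambda>c. fst ` set c) F" "(\<Union>c\<in>F. fst ` set c) = fst ` N - fst ` set c"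
      using IH by (elim exE conjE) (rule that)
    have new: "c \<notin> F"
    proof
      assume "c \<in> F"
      then have "fst e \<in> fst ` N - fst ` set c"
        using F(4) \<open>e \<in> set c\<close> by blast
      then show False
        using \<open>e \<in> set c\<close> by simp
    qed
    show ?thesis
    proof (intro exI[of _ "insert c F"] conjI)
      show "disjoint_family_on (\<lambda>c. fst ` set c) (insert c F)"
        using F(3,4) new by (subst disjoint_family_on_insert) auto
      show "(\<Union>c\<in>insert c F. fst ` set c) = fst ` N"
        using F(4) c(2) by auto
    qed (use F c in auto)
  qed
qed

section \<open>Spanning the states of the system digraph\<close>

lemma pair_wf_system_digraph: "pair_wf_digraph (system_digraph n I J A B C K)"
  by unfold_locales (auto simp: system_digraph_def)

text \<open>The union of the arc sets of disjoint cycles is the graph of a permutation. The cycle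
  decomposition gives the converse, with \<open>N\<close> finite because the digraph is.\<close>

lemma states_spanned_iff_permutation_arcs:
  assumes "finite I" "finite J"
  shows "states_spanned_by_disjoint_cycles n (system_digraph n I J A B C K) \<longleftrightarrow>
    (\<exists>N. permutation_arcs N \<and> N \<subseteq> parcs (system_digraph n I J A B C K) \<and>
         X ` {1..n} \<subseteq> fst ` N)"
    (is "?L \<longleftrightarrow> ?R")
proof
  let ?D = "system_digraph n I J A B C K"
  assume ?L
  then obtain F where F: "\<forall>c\<in>F. pre_digraph.cycle (with_proj ?D) c"
    "disjoint_family_on (\<lambda>c. fst ` set c) F" "X ` {1..n} \<subseteq> (\<Union>c\<in>F. fst ` set c)"
    by (auto simp: states_spanned_by_disjoint_cycles_def)
  have "permutation_arcs (\<Union>(set ` F))"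
  proof (rule permutation_arcs_Union)
    fix L L' assume "L \<in> set ` F" "L' \<in> set ` F" "L \<noteq> L'"
    then obtain c c' where "c \<in> F" "c' \<in> F" "c \<noteq> c'" "L = set c" "L' = set c'"
      by blast
    then show "fst ` L \<inter> fst ` L' = {}"
      using disjoint_family_onD[OF F(2)] by simp
  qed (use F(1) permutation_arcs_cycle in blast)
  moreover have "\<Union>(set ` F) \<subseteq> parcs ?D"
    using F(1) by (auto simp: cycle_with_proj)
  moreover have "X ` {1..n} \<subseteq> fst ` \<Union>(set ` F)"
    using F(3) by (simp add: image_UN)
  ultimately show ?R
    by blast
next
  let ?D = "system_digraph n I J A B C K"
  assume ?R
  then obtain N where N: "permutation_arcs N" "N \<subseteq> parcs ?D" "X ` {1..n} \<subseteq> fst ` N"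
    by blast
  have "parcs ?D \<subseteq> pverts ?D \<times> pverts ?D"
    by (auto simp: system_digraph_def)
  moreover have "finite (pverts ?D)"
    using assms by (simp add: system_digraph_def)
  ultimately have "finite N"
    using N(2) by (meson finite_SigmaI finite_subset)
  then show ?L
    using permutation_arcs_cycle_decomposition[OF pair_wf_system_digraph _ N(1,2)] N(3)
    unfolding states_spanned_by_disjoint_cycles_def by metis
qed

section \<open>Perfect matchings and their selections\<close>

text \<open>The matching condition is injectivity of both projections. Left and right copies of a
  vertex are the same value, so perfectness makes the two images equal.\<close>

lemma perfect_matching_system_iff:
  "perfect_matching (system_bipartite_graph n m p A B C K) M \<longleftrightarrow>
    M \<subseteq> edges (system_bipartite_graph n m p A B C K) \<and> permutation_arcs M \<and>
    fst ` M = X ` {1..n} \<union> U ` {1..m} \<union> Y ` {1..p}"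
  by (auto simp: perfect_matching_def matching_def permutation_arcs_def inj_on_def
      system_bipartite_graph_def)

context
  fixes n m p :: nat and A B C K :: structural_matrix and M :: "(vertex \<times> vertex) set"
  assumes perfect: "perfect_matching (system_bipartite_graph n m p A B C K) M"
begin

lemma matched_permutation_arcs: "permutation_arcs M"
  and fst_image_matched: "fst ` M = X ` {1..n} \<union> U ` {1..m} \<union> Y ` {1..p}"
  and matched_subset_edges: "M \<subseteq> edges (system_bipartite_graph n m p A B C K)"
  using perfect unfolding perfect_matching_system_iff by blast+

lemma matched_right_unique: "(v, w) \<in> M \<Longrightarrow> (v, w') \<in> M \<Longrightarrow> w = w'"
  using matched_permutation_arcs unfolding permutation_arcs_def
  by (metis fst_conv inj_onD snd_conv)

lemma matched_left_unique: "(v, w) \<in> M \<Longrightarrow> (v', w) \<in> M \<Longrightarrow> v = v'"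
  using matched_permutation_arcs unfolding permutation_arcs_def
  by (metis fst_conv inj_onD snd_conv)

lemma matched_edges:
  "(v, w) \<in> M \<Longrightarrow> (v, w) \<in> edges (system_bipartite_graph n m p A B C K)"
  using matched_subset_edges by blast

lemma matched_verts:
  assumes "v \<in> X ` {1..n} \<union> U ` {1..m} \<union> Y ` {1..p}"
  shows "\<exists>w. (v, w) \<in> M" and "\<exists>w. (w, v) \<in> M"
proof -
  have "v \<in> fst ` M" "v \<in> snd ` M"
    using assms fst_image_matched matched_permutation_arcs unfolding permutation_arcs_def
    by simp_all
  then show "\<exists>w. (v, w) \<in> M" "\<exists>w. (w, v) \<in> M"
    by force+
qed

text \<open>The left copy of \<open>U i\<close> is matched to some \<open>Y j\<close> or by the
  loop, and the right copy to some \<open>X k\<close> or by the loop. The loop occupies both copies,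
  so either both use it or neither does.\<close>

lemma selected_inputs_iff: "i \<in> selected_inputs M \<longleftrightarrow> (\<exists>j. (U i, Y j) \<in> M)"
proof
  assume "i \<in> selected_inputs M"
  then obtain k where k: "(X k, U i) \<in> M"
    by (auto simp: selected_inputs_def)
  then have "i \<in> {1..m}"
    using matched_edges by (fastforce simp: system_bipartite_graph_def)
  then obtain w where w: "(U i, w) \<in> M"
    using matched_verts by blast
  moreover have "w \<noteq> U i"
    using w k matched_left_unique by blast
  ultimately show "\<exists>j. (U i, Y j) \<in> M"
    using matched_edges[OF w] by (auto simp: system_bipartite_graph_def)
next
  assume "\<exists>j. (U i, Y j) \<in> M"
  then obtain j where j: "(U i, Y j) \<in> M" ..
  then have "i \<in> {1..m}"
    using matched_edges by (fastforce simp: system_bipartite_graph_def)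
  then obtain w where w: "(w, U i) \<in> M"
    using matched_verts by blast
  moreover have "w \<noteq> U i"
    using w j matched_right_unique by blast
  ultimately show "i \<in> selected_inputs M"
    using matched_edges[OF w] by (auto simp: system_bipartite_graph_def selected_inputs_def)
qed

text \<open>The same alternative at \<open>Y j\<close>, whose left copy is adjacent to states and
  whose right copy is adjacent to inputs, apart from the loop.\<close>

lemma selected_outputs_iff: "j \<in> selected_outputs M \<longleftrightarrow> (\<exists>i. (U i, Y j) \<in> M)"
proof
  assume "j \<in> selected_outputs M"
  then obtain k where k: "(Y j, X k) \<in> M"
    by (auto simp: selected_outputs_def)
  then have "j \<in> {1..p}"
    using matched_edges by (fastforce simp: system_bipartite_graph_def)
  then obtain w where w: "(w, Y j) \<in> M"
    using matched_verts by blast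
  moreover have "w \<noteq> Y j"
    using w k matched_right_unique by blast
  ultimately show "\<exists>i. (U i, Y j) \<in> M"
    using matched_edges[OF w] by (auto simp: system_bipartite_graph_def)
next
  assume "\<exists>i. (U i, Y j) \<in> M"
  then obtain i where i: "(U i, Y j) \<in> M" ..
  then have "j \<in> {1..p}"
    using matched_edges by (fastforce simp: system_bipartite_graph_def)
  then obtain w where w: "(Y j, w) \<in> M"
    using matched_verts by blast
  moreover have "w \<noteq> Y j"
    using w i matched_left_unique by blast
  ultimately show "j \<in> selected_outputs M"
    using matched_edges[OF w] by (auto simp: system_bipartite_graph_def selected_outputs_def)
qed

lemma finite_matched: "finite M"
proof -
  have "finite (fst ` M)"
    by (simp add: fst_image_matched)
  then show ?thesis
    using matched_permutation_arcs finite_imageD unfolding permutation_arcs_def by blast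
qed

text \<open>The feedback edges of \<open>M\<close> pair the selected inputs bijectively with the
  selected outputs, so each selected price is paid exactly once.\<close>

lemma matching_cost_eq_selection_cost:
  "matching_cost (edge_cost pu py) M =
    selection_cost pu py (selected_inputs M) (selected_outputs M)"
proof -
  \<comment> \<open>The index pairs of the feedback edges. All other edges cost 0.\<close>
  define S where "S = {(i, j). (U i, Y j) \<in> M}"
  have inj: "inj_on fst S" "inj_on snd S"
    by (auto simp: S_def inj_on_def dest: matched_right_unique matched_left_unique)
  have image: "fst ` S = selected_inputs M" "snd ` S = selected_outputs M"
    by (auto simp: S_def selected_inputs_iff selected_outputs_iff image_iff)
  have "matching_cost (edge_cost pu py) M = (\<Sum>e\<in>map_prod U Y ` S. edge_cost pu py e)"
    unfolding matching_cost_def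
  proof (rule sum.mono_neutral_right)
    show "\<forall>e\<in>M - map_prod U Y ` S. edge_cost pu py e = 0"
    proof
      fix e assume e: "e \<in> M - map_prod U Y ` S"
      show "edge_cost pu py e = 0"
        using e by (cases "(pu, py, e)" rule: edge_cost.cases) (force simp: S_def)+
    qed
  qed (auto simp: finite_matched S_def)
  also have "\<dots> = (\<Sum>e\<in>S. edge_cost pu py (map_prod U Y e))"
    by (subst sum.reindex) (auto simp: inj_on_def)
  also have "\<dots> = (\<Sum>e\<in>S. pu (fst e)) + (\<Sum>e\<in>S. py (snd e))"
    unfolding sum.distrib[symmetric] by (intro sum.cong) auto
  also have "\<dots> = selection_cost pu py (selected_inputs M) (selected_outputs M)"
    unfolding selection_cost_def image[symmetric] by (simp add: sum.reindex inj)
  finally show ?thesis .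
qed

lemma cycle_feasible_selected:
  "cycle_feasible n m p A B C K (selected_inputs M) (selected_outputs M)"
proof -
  let ?I = "selected_inputs M" and ?J = "selected_outputs M"
  \<comment> \<open>Loops at states are excluded from \<open>L\<close>: they come from
    \<open>A\<close> and are genuine cycles of the digraph, whereas loops at inputs and outputs are
    not arcs of it.\<close>
  define L where "L = Id_on {v. (v, v) \<in> M \<and> v \<notin> range X}"
  have L: "permutation_arcs L" "L \<subseteq> M"
    by (auto simp: L_def permutation_arcs_Id_on)
  note rest = permutation_arcs_Diff[OF matched_permutation_arcs L]
  have sub: "?I \<subseteq> {1..m}" "?J \<subseteq> {1..p}"
    using matched_edges
    by (fastforce simp: selected_inputs_def selected_outputs_def system_bipartite_graph_def)+
  have "(M - L)\<inverse> \<subseteq> parcs (system_digraph n ?I ?J A B C K)"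
  proof (rule subrelI)
    fix w v assume "(w, v) \<in> (M - L)\<inverse>"
    then have vw: "(v, w) \<in> M" "(v, w) \<notin> L"
      by auto
    \<comment> \<open>These facts treat the edges whose reversed arcs survive in the restricted
      digraph only if their input and output labels are selected.\<close>
    have "i \<in> ?I" if "v = X k" "w = U i" for k i
      using vw that by (auto simp: selected_inputs_def)
    moreover have "j \<in> ?J" if "v = Y j" "w = X k" for k j
      using vw that by (auto simp: selected_outputs_def)
    moreover have "i \<in> ?I \<and> j \<in> ?J" if "v = U i" "w = Y j" for i j
      using vw that selected_inputs_iff selected_outputs_iff by blast
    ultimately show "(w, v) \<in> parcs (system_digraph n ?I ?J A B C K)"
      using matched_edges[OF vw(1)] vw
      by (auto simp: system_bipartite_graph_def system_digraph_def L_def)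
  qed
  moreover have "permutation_arcs ((M - L)\<inverse>)"
    by (simp add: permutation_arcs_converse rest)
  moreover have "X ` {1..n} \<subseteq> fst ` ((M - L)\<inverse>)"
  proof -
    have "fst ` ((M - L)\<inverse>) = snd ` (M - L)"
      by (rule fst_image_converse)
    also have "\<dots> = fst ` M - fst ` L"
      using rest by (simp add: permutation_arcs_def)
    finally show ?thesis
      by (auto simp: fst_image_matched L_def image_Id_on)
  qed
  ultimately have "states_spanned_by_disjoint_cycles n (system_digraph n ?I ?J A B C K)"
    using sub by (subst states_spanned_iff_permutation_arcs) (blast intro: finite_subset)+
  with sub show ?thesis
    by (simp add: cycle_feasible_def)
qed

end

section \<open>From feasible selections to perfect matchings\<close>

text \<open>Reversing the cycles and adding loops at the vertices they miss gives the matching. Only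
  inclusions are claimed, as an index in \<open>I\<close> or \<open>J\<close> whose vertex lies on
  no cycle gets a loop and is not selected.\<close>

lemma cycle_feasible_imp_perfect_matching:
  assumes "cycle_feasible n m p A B C K I J"
  shows "\<exists>M. perfect_matching (system_bipartite_graph n m p A B C K) M \<and>
    selected_inputs M \<subseteq> I \<and> selected_outputs M \<subseteq> J"
proof -
  let ?V = "X ` {1..n} \<union> U ` {1..m} \<union> Y ` {1..p}"
  have sub: "I \<subseteq> {1..m}" "J \<subseteq> {1..p}"
    using assms by (auto simp: cycle_feasible_def)
  then obtain N where N: "permutation_arcs N" "N \<subseteq> parcs (system_digraph n I J A B C K)"
      "X ` {1..n} \<subseteq> fst ` N"
    using assms states_spanned_iff_permutation_arcs[OF finite_subset[OF sub(1)] finite_subset[OF sub(2)]]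
    by (auto simp: cycle_feasible_def)
  \<comment> \<open>Since \<open>N\<close> passes through all states, these loops sit at inputs and
    outputs only, where the bipartite graph has them.\<close>
  define L where "L = Id_on (?V - fst ` N)"
  define M where "M = N\<inverse> \<union> L"
  have eq: "fst ` (N\<inverse>) = fst ` N" "fst ` L = ?V - fst ` N"
    using N(1) by (auto simp: permutation_arcs_def L_def image_Id_on fst_image_converse)
  have "permutation_arcs (\<Union>{N\<inverse>, L})"
  proof (rule permutation_arcs_Union)
    show "permutation_arcs S" if "S \<in> {N\<inverse>, L}" for S
      using that N(1) by (auto simp: L_def permutation_arcs_Id_on permutation_arcs_converse)
    have "fst ` N\<inverse> \<inter> fst ` L = {}"
      unfolding eq by blast
    then show "fst ` S \<inter> fst ` S' = {}" if "S \<in> {N\<inverse>, L}" "S' \<in> {N\<inverse>, L}" "S \<noteq> S'" for S S'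
      using that by (simp only: insert_iff empty_iff) (elim disjE; simp add: Int_commute)
  qed
  then have "permutation_arcs M"
    by (simp add: M_def)
  moreover have "parcs (system_digraph n I J A B C K) \<subseteq> ?V \<times> ?V"
    using sub by (auto simp: system_digraph_def)
  then have "fst ` N \<subseteq> ?V"
    using N(2) by (intro image_subsetI) (metis mem_Times_iff subsetD)
  then have "fst ` M = ?V"
    using eq by (auto simp: M_def image_Un)
  moreover have "N\<inverse> \<subseteq> edges (system_bipartite_graph n m p A B C K)"
  proof (rule subrelI)
    fix v w assume "(v, w) \<in> N\<inverse>"
    then have "(w, v) \<in> parcs (system_digraph n I J A B C K)"
      using N(2) by blast
    then show "(v, w) \<in> edges (system_bipartite_graph n m p A B C K)"
      by (auto simp: system_digraph_def system_bipartite_graph_def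
          dest!: subsetD[OF sub(1)] subsetD[OF sub(2)])
  qed
  moreover have "L \<subseteq> edges (system_bipartite_graph n m p A B C K)"
    using N(3) by (auto simp: L_def system_bipartite_graph_def)
  ultimately have "perfect_matching (system_bipartite_graph n m p A B C K) M"
    by (simp add: perfect_matching_system_iff M_def)
  moreover have "selected_inputs M \<subseteq> I" "selected_outputs M \<subseteq> J"
    using N(2)
    by (auto simp: selected_inputs_def selected_outputs_def M_def L_def system_digraph_def)
  ultimately show ?thesis
    by blast
qed

section \<open>Equality of the optimal costs\<close>

theorem theorem5:
  fixes n m p :: nat
    and A B C K :: structural_matrix
    and pu py :: "nat \<Rightarrow> real"
    and I_opt J_opt :: "nat set"
  assumes pu_nonneg: "\<forall>i\<in>{1..m}. 0 \<le> pu i"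
    and py_nonneg: "\<forall>j\<in>{1..p}. 0 \<le> py j"
    and spanned: "states_spanned_by_disjoint_cycles n (system_digraph n {1..m} {1..p} A B C K)"
    and optimal: "cycle_optimal n m p A B C K pu py I_opt J_opt"
  shows "(\<exists>M. min_cost_perfect_matching (system_bipartite_graph n m p A B C K) (edge_cost pu py) M)
    \<and> perfect_matching_opt_cost (system_bipartite_graph n m p A B C K) (edge_cost pu py)
        = selection_cost pu py I_opt J_opt
    \<and> (\<forall>M. min_cost_perfect_matching (system_bipartite_graph n m p A B C K) (edge_cost pu py) M \<longrightarrow>
          cycle_optimal n m p A B C K pu py (selected_inputs M) (selected_outputs M))"
proof -
  let ?G = "system_bipartite_graph n m p A B C K" and ?c = "edge_cost pu py"
  let ?opt = "selection_cost pu py I_opt J_opt"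
  have feasible: "cycle_feasible n m p A B C K I_opt J_opt"
    using optimal by (simp add: cycle_optimal_def is_arg_min_def)
  have least: "?opt \<le> selection_cost pu py I J" if "cycle_feasible n m p A B C K I J" for I J
    using optimal that by (force simp: cycle_optimal_def is_arg_min_linorder)+
  \<comment> \<open>The selection of a perfect matching is feasible and has the cost of the
    matching.\<close>
  have lower: "?opt \<le> matching_cost ?c M" if "perfect_matching ?G M" for M
    using least[OF cycle_feasible_selected[OF that]] matching_cost_eq_selection_cost[OF that] by simp
  obtain M where M: "perfect_matching ?G M" "selected_inputs M \<subseteq> I_opt" "selected_outputs M \<subseteq> J_opt"
    using cycle_feasible_imp_perfect_matching feasible by blast
  have sub: "I_opt \<subseteq> {1..m}" "J_opt \<subseteq> {1..p}"
    using feasible by (auto simp: cycle_feasible_def)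
  \<comment> \<open>The selection of \<open>M\<close> may be smaller than the optimal one. By
    nonnegativity of the prices, dropping indices does not raise the cost.\<close>
  have "matching_cost ?c M \<le> ?opt"
    unfolding matching_cost_eq_selection_cost[OF M(1)] selection_cost_def
    using M sub pu_nonneg py_nonneg
    by (intro add_mono sum_mono2) (auto intro: finite_subset)
  then have cost: "matching_cost ?c M = ?opt"
    using lower[OF M(1)] by simp
  \<comment> \<open>The lower bound is attained at \<open>M\<close>, so the minimizers are the
    perfect matchings of cost \<open>?opt\<close>.\<close>
  have min: "min_cost_perfect_matching ?G ?c M' \<longleftrightarrow>
      perfect_matching ?G M' \<and> matching_cost ?c M' = ?opt" for M'
    unfolding min_cost_perfect_matching_def is_arg_min_linorder
    using lower M(1) cost by (metis antisym)
  have "perfect_matching_opt_cost ?G ?c = ?opt"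
    unfolding perfect_matching_opt_cost_def
  proof (rule cInf_eq_minimum)
    show "?opt \<in> matching_cost ?c ` {M. perfect_matching ?G M}"
      using M(1) cost[symmetric] by blast
  qed (use lower in auto)
  moreover have "cycle_optimal n m p A B C K pu py (selected_inputs M') (selected_outputs M')"
    if "min_cost_perfect_matching ?G ?c M'" for M'
  proof -
    have M': "perfect_matching ?G M'" "matching_cost ?c M' = ?opt"
      using that min by auto
    then show ?thesis
      using least cycle_feasible_selected[OF M'(1)] matching_cost_eq_selection_cost[OF M'(1)]
      by (auto simp: cycle_optimal_def is_arg_min_linorder)
  qed
  ultimately show ?thesis
    using M(1) cost min by blast
qed

end
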